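(* Let $q\in\mathbb C$ with $0<|q|<1$, $m\in\mathbb Z$, $\sigma\in(0,\infty)$, $z=\mathrm e^{i\psi}$, let $B\ge 0$, $D\ge 1$ be integers with $D\ge B$, and let ${\bf b}=\{b_1,\dots,b_B\}$, ${\bf d}=\{d_1,\dots,d_D\}$ be non-zero complex numbers such that $|q|/\sigma<|d_k|<1/\sigma$ for $k=1,\dots,D$ and $d_l/d_k\notin\{q^j:j\in\mathbb Z\}$ for all $l\ne k$. Then $$\int_{-\pi}^{\pi}\frac{\vartheta({\bf b}\frac{\sigma}{z};q)}{\vartheta({\bf d}\frac{\sigma}{z};q)}\,\mathrm e^{im\psi}\,\mathrm d\psi=\frac{2\pi\sigma^m}{(q;q)_\infty}\,G_m,\qquad G_m:=G_m\!\left(\tfrac{q}{\bf b},{\bf b},\tfrac{q}{\bf d},{\bf d};\sigma,q\right),$$ where $G_m$ has the following evaluations. (i) If $D\ge B$ (and, in the case $D=B$, $|q^m b_1\cdots b_B|<|d_1\cdots d_D|$), then $$G_m=\frac{1}{(q;q)_\infty}\sum_{k=1}^D\frac{\vartheta({\bf b}/d_k;q)\,d_k^m}{\vartheta({\bf d}_{[k]}/d_k;q)}\;\Phi_{D-B}\!\left(q^m(qd_k)^{D-B}\frac{b_1\cdots b_B}{d_1\cdots d_D}\right),\qquad \Phi_p(x):=\sum_{n=0}^\infty\left((-1)^nq^{\binom n2}\right)^{p}x^n .$$ (ii) If $D=B$ and $|q^m b_1\cdots b_B|<|d_1\cdots d_D|$, then $$G_m=\frac{1}{(q;q)_\infty}\sum_{k=1}^D\frac{\vartheta({\bf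 b}/d_k;q)\,d_k^m}{\vartheta({\bf d}_{[k]}/d_k;q)}\;\frac{1}{1-q^m\frac{b_1\cdots b_B}{d_1\cdots d_B}} .$$ (iii) If $D>B$, then $$G_m=\frac{(q^{D-B};q^{D-B})_\infty}{(q;q)_\infty}\sum_{k=1}^D\frac{\vartheta({\bf b}/d_k;q)\,d_k^m}{\vartheta({\bf d}_{[k]}/d_k;q)}\;\Theta\!\left(-\frac{q^m(-qd_k)^{D-B}b_1\cdots b_B}{d_1\cdots d_D};q^{D-B}\right).$$
   Context: Notation. $(a;q)_\infty=\prod_{n\ge0}(1-aq^n)$ and $(a_1,\dots,a_k;q)_\infty=\prod_j(a_j;q)_\infty$. Theta function: $\vartheta(x;q)=(x,q/x;q)_\infty$ for $x\ne0$. Partial theta function: $\Theta(x;q)=\frac1{(q;q)_\infty}\sum_{n=0}^\infty(-1)^nq^{\binom n2}x^n$. For a finite list ${\bf a}=\{a_1,\dots,a_A\}$ and a scalar $t$: $t{\bf a}=\{ta_1,\dots,ta_A\}$, $t/{\bf a}=\{t/a_1,\dots,t/a_A\}$, ${\bf a}_{[k]}={\bf a}\setminus\{a_k\}$; $({\bf a};q)_\infty$ and $\vartheta({\bf a};q)$ denote the products of $(a_j;q)_\infty$, respectively $\vartheta(a_j;q)$, over the list (empty products are $1$). For finite lists ${\bf a},{\bf b},{\bf c},{\bf d}$ of non-zero complex numbers with $|c_k|<\sigma$, $|d_l|<1/\sigma$, the $q$-Mellin--Barnes integral is $$G_m({\bf a},{\bf b},{\bf c},{\bf d};\sigma,q)=\frac{(q;q)_\infty}{2\pi}\,\sigma^{-m}\int_{-\pi}^{\pi}\frac{({\bf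 b}\frac{\sigma}{z},{\bf a}\frac{z}{\sigma};q)_\infty}{({\bf d}\frac{\sigma}{z},{\bf c}\frac{z}{\sigma};q)_\infty}\,\mathrm e^{im\psi}\,\mathrm d\psi,\qquad z=\mathrm e^{i\psi}.$$ *)

theory Defs
  imports "HOL-Analysis.Analysis"
begin

definition qpoch :: "complex \<Rightarrow> complex \<Rightarrow> complex" where
  "qpoch a q = (\<Prod>n. 1 - a * q ^ n)"

definition qpoch_list :: "complex list \<Rightarrow> complex \<Rightarrow> complex" where
  "qpoch_list as q = (\<Prod>a\<leftarrow>as. qpoch a q)"

definition qtheta :: "complex \<Rightarrow> complex \<Rightarrow> complex" where
  "qtheta x q = qpoch x q * qpoch (q / x) q"

definition qtheta_list :: "complex list \<Rightarrow> complex \<Rightarrow> complex" where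
  "qtheta_list xs q = (\<Prod>x\<leftarrow>xs. qtheta x q)"

definition partial_theta :: "complex \<Rightarrow> complex \<Rightarrow> complex" where
  "partial_theta x q = 1 / qpoch q q * (\<Sum>n. (-1) ^ n * q ^ (n choose 2) * x ^ n)"

definition Phi :: "complex \<Rightarrow> nat \<Rightarrow> complex \<Rightarrow> complex" where
  "Phi q p x = (\<Sum>n. ((-1) ^ n * q ^ (n choose 2)) ^ p * x ^ n)"

definition scale_list :: "complex \<Rightarrow> complex list \<Rightarrow> complex list" where
  "scale_list t as = map (\<lambda>a. t * a) as"

definition recip_list :: "complex \<Rightarrow> complex list \<Rightarrow> complex list" where
  "recip_list t as = map (\<lambda>a. t / a) as"

text \<open>Removes the entry at position \<open>k\<close> only; equal entries elsewhere are kept.\<close>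

definition drop_nth :: "nat \<Rightarrow> 'a list \<Rightarrow> 'a list" where
  "drop_nth k as = take k as @ drop (Suc k) as"

text \<open>Meaningful when \<open>norm c < \<sigma>\<close> for all \<open>c\<close> in \<open>cs\<close> and \<open>norm d < 1 / \<sigma>\<close> for all \<open>d\<close> in \<open>ds\<close>.\<close>

definition q_Mellin_Barnes ::
  "int \<Rightarrow> complex list \<Rightarrow> complex list \<Rightarrow> complex list \<Rightarrow> complex list \<Rightarrow> real \<Rightarrow> complex \<Rightarrow> complex" where
  "q_Mellin_Barnes m as bs cs ds \<sigma> q =
     qpoch q q / (2 * of_real pi) * of_real \<sigma> powi (- m) *
     integral {-pi..pi} (\<lambda>\<psi>. let z = cis \<psi> in
       (qpoch_list (scale_list (of_real \<sigma> / z) bs) q * qpoch_list (scale_list (z / of_real \<sigma>) as) q) /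
       (qpoch_list (scale_list (of_real \<sigma> / z) ds) q * qpoch_list (scale_list (z / of_real \<sigma>) cs) q) *
       exp (\<i> * of_int m * of_real \<psi>))"

end

theory Submission
  imports Defs "HOL-Complex_Analysis.Complex_Analysis"
begin

text \<open>
  Put \<open>w = \<sigma> / z\<close> and let \<open>F n w = \<theta>(b w) / \<theta>(d w) \<cdot> w powi (-n)\<close>, a meromorphic function on the
  punctured plane. Up to the factor \<open>2 \<pi> \<sigma> powi m\<close> the integral is the mean \<open>moment m\<close> of \<open>F m\<close>
  over the circle of radius \<open>\<sigma>\<close>. Its poles are among the points \<open>q powi j / d ! k\<close>, and summing the
  residues at those outside the circle gives the result. To avoid a contour that encloses more and
  more poles, the proof treats one layer of poles and reuses it by means of a functional equation.

  The theta function satisfies \<open>\<theta>(x / q) = - (x / q) \<theta>(x)\<close>, so replacing \<open>w\<close> by \<open>w / q\<close> turns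
  \<open>F n\<close> into a constant multiple of \<open>F (n + p)\<close> with \<open>p = D - B\<close>. Geometrically this replacement moves
  the circle of radius \<open>\<sigma>\<close> to the circle of radius \<open>\<sigma> / norm q\<close>, and the bounds on the \<open>d ! k\<close>
  say exactly that, among these points, the annulus in between contains the \<open>1 / d ! k\<close> and no others.
  Since the \<open>d ! k\<close> are distinct, \<open>F n\<close> has at most simple poles there. Comparing the two circles
  (\<open>circle_mean_dilate_simple_poles\<close>) therefore yields a recursion (\<open>moment_step\<close>)
  that expresses \<open>moment n\<close> as a finite sum of residues plus \<open>\<kappa> \<cdot> q powi n \<cdot> moment (n + p)\<close>.

  Iterating the recursion (\<open>moment_iterate\<close>) accumulates the weights
  \<open>(q ^ (i choose 2)) ^ p \<cdot> (\<kappa> \<cdot> q powi m) ^ i\<close>, which are those of the series \<open>Phi\<close> up to a sign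
  \<open>(-1) ^ p\<close> in its argument. Since \<open>moment n\<close> is \<open>O(\<sigma> powi (-n))\<close>, the remainder after \<open>N\<close> steps
  is dominated by the \<open>N\<close>-th term of a convergent series of the same shape: for \<open>p > 0\<close> by the Gaussian decay of the weights, for
  \<open>p = 0\<close> because the series is geometric with ratio smaller than 1 by hypothesis. Hence the
  remainder vanishes in the limit (\<open>moment_eq_sum_Phi\<close>). The two special forms of the result
  are the geometric series and a termwise comparison with the partial theta function.
\<close>

section \<open>Infinite products and theta functions\<close>

text \<open>The notation \<open>prodinf\<close> is meaningful only for convergent products; here convergence is absolute.\<close>

lemma qpoch_has_prod:
  assumes "norm q < 1"
  shows "(\<lambda>n. 1 - a * q ^ n) has_prod qpoch a q"
proof -
  have "summable (\<lambda>n. norm ((1 - a * q ^ n) - 1))"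
    using assms by (simp add: norm_mult norm_power summable_geometric)
  then have "convergent_prod (\<lambda>n. 1 - a * q ^ n)"
    by (intro abs_convergent_prod_imp_convergent_prod summable_imp_abs_convergent_prod)
  then show ?thesis
    unfolding qpoch_def by blast
qed

lemma qpoch_nonzero:
  assumes "norm q < 1" "norm a < 1"
  shows "qpoch a q \<noteq> 0"
proof
  assume "qpoch a q = 0"
  then obtain n where "a * q ^ n = 1"
    using has_prod_eq_0_iff[OF qpoch_has_prod[OF assms(1), of a]] by auto
  moreover have "norm (a * q ^ n) < 1"
    using assms mult_left_le[of "norm q ^ n" "norm a"] power_le_one[of "norm q" n]
    by (simp add: norm_mult norm_power)
  ultimately show False
    by simp
qed

lemma qpoch_step:
  assumes "norm q < 1"
  shows "qpoch a q = (1 - a) * qpoch (q * a) q"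
proof -
  have "(\<lambda>n. 1 - a * q ^ n) has_prod ((\<Prod>k<1. 1 - a * q ^ k) * (\<Prod>k. 1 - a * q ^ (k + 1)))"
    using qpoch_has_prod[OF assms] by (intro has_prod_ignore_initial_segment') (auto simp: has_prod_iff)
  moreover have "(\<Prod>k. 1 - a * q ^ (k + 1)) = qpoch (q * a) q"
    unfolding qpoch_def by (simp add: mult_ac)
  ultimately show ?thesis
    using has_prod_unique2[OF qpoch_has_prod[OF assms, of a]] by simp
qed

text \<open>The finite products converge uniformly on every closed disc of radius 1, by the Weierstrass test.\<close>

lemma holomorphic_qpoch:
  assumes "norm q < 1"
  shows "(\<lambda>a. qpoch a q) holomorphic_on UNIV"
proof (rule holomorphic_uniform_sequence)
  fix z :: complex
  let ?f = "\<lambda>n a. 1 - a * q ^ n"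
  have "uniformly_convergent_on (cball z 1) (\<lambda>N a. \<Sum>n<N. norm (?f n a - 1))"
  proof (rule Weierstrass_m_test')
    show "norm (norm (?f n a - 1)) \<le> (norm z + 1) * norm q ^ n" if "a \<in> cball z 1" for n a
    proof -
      have "norm a \<le> norm z + 1"
        using that norm_triangle_ineq2[of a z] by (simp add: dist_norm norm_minus_commute)
      then show ?thesis
        by (simp add: norm_mult norm_power mult_right_mono)
    qed
    show "summable (\<lambda>n. (norm z + 1) * norm q ^ n)"
      using assms by (simp add: summable_geometric)
  qed
  then have "uniformly_convergent_on (cball z 1) (\<lambda>N a. \<Prod>n<N. ?f n a)"
    by (intro uniformly_convergent_on_prod' continuous_intros) auto
  then obtain l where l: "uniform_limit (cball z 1) (\<lambda>N a. \<Prod>n<N. ?f n a) l sequentially"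
    by (auto simp: uniformly_convergent_on_def)
  have "l a = qpoch a q" if "a \<in> cball z 1" for a
    using tendsto_uniform_limitI[OF l that] has_prod_imp_tendsto'[OF qpoch_has_prod[OF assms]]
      LIMSEQ_unique by blast
  then have "uniform_limit (cball z 1) (\<lambda>N a. \<Prod>n<N. ?f n a) (\<lambda>a. qpoch a q) sequentially"
    using l uniform_limit_cong'[of "cball z 1"] by (metis (no_types, lifting))
  then show "\<exists>d>0. cball z d \<subseteq> UNIV \<and>
      uniform_limit (cball z d) (\<lambda>N a. \<Prod>n<N. ?f n a) (\<lambda>a. qpoch a q) sequentially"
    by (intro exI[of _ 1]) auto
qed (auto intro!: holomorphic_intros)

lemma holomorphic_on_qpoch [holomorphic_intros]:
  assumes "norm q < 1" "g holomorphic_on S"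
  shows "(\<lambda>w. qpoch (g w) q) holomorphic_on S"
  using holomorphic_on_compose_gen[OF assms(2) holomorphic_qpoch[OF assms(1)]]
  by (simp add: o_def)

text \<open>Dividing \<open>x\<close> by \<open>q\<close> adds the factor \<open>1 - x / q\<close> to one product and removes \<open>1 - q / x\<close> from the
  other; the quotient of these factors is \<open>- (x / q)\<close>.\<close>

lemma qtheta_step_down:
  assumes "norm q < 1" "q \<noteq> 0" "x \<noteq> 0"
  shows "qtheta (x / q) q = - (x / q) * qtheta x q"
proof -
  have "qpoch (x / q) q = (1 - x / q) * qpoch x q"
    using qpoch_step[OF assms(1), of "x / q"] assms(2) by simp
  moreover have "qpoch (q / x) q = (1 - q / x) * qpoch (q / (x / q)) q"
    using qpoch_step[OF assms(1), of "q / x"] by simp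
  moreover have "1 - x / q = - (x / q) * (1 - q / x)"
    using assms(2,3) by (simp add: field_simps)
  ultimately show ?thesis
    unfolding qtheta_def by (simp only: mult_ac)
qed

text \<open>Isolates the zero at \<open>x = 1\<close>: the remaining two products do not vanish when
  \<open>norm q < norm x < 1 / norm q\<close>.\<close>

lemma qtheta_factor:
  assumes "norm q < 1"
  shows "qtheta x q = (1 - x) * (qpoch (q * x) q * qpoch (q / x) q)"
  unfolding qtheta_def by (subst qpoch_step[OF assms]) simp

lemma qtheta_list_scale:
  "qtheta_list (scale_list t xs) q = (\<Prod>k<length xs. qtheta (t * xs ! k) q)"
  unfolding qtheta_list_def scale_list_def
  by (simp add: prod.list_conv_set_nth atLeast0LessThan)

lemma prod_list_map_drop_nth:
  fixes f :: "'a \<Rightarrow> 'b::comm_monoid_mult"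
  assumes "k < length xs"
  shows "prod_list (map f (drop_nth k xs)) = (\<Prod>i\<in>{..<length xs} - {k}. f (xs ! i))"
  using assms
proof (induction xs arbitrary: k)
  case (Cons x xs)
  show ?case
  proof (cases k)
    case 0
    have "{..<length (x # xs)} - {0} = Suc ` {..<length xs}"
      by (auto simp: image_iff less_Suc_eq_0_disj)
    then show ?thesis
      using 0 by (simp add: drop_nth_def prod.list_conv_set_nth prod.reindex atLeast0LessThan)
  next
    case (Suc j)
    have "{..<length (x # xs)} - {Suc j} = insert 0 (Suc ` ({..<length xs} - {j}))"
      by (auto simp: image_iff less_Suc_eq_0_disj)
    then show ?thesis
      using Suc Cons.prems Cons.IH[of j] by (simp add: drop_nth_def prod.reindex)
  qed
qed simp

lemma qtheta_list_scale_drop_nth: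
  assumes "k < length xs"
  shows "qtheta_list (scale_list t (drop_nth k xs)) q = (\<Prod>i\<in>{..<length xs} - {k}. qtheta (t * xs ! i) q)"
  using prod_list_map_drop_nth[OF assms, of "\<lambda>x. qtheta (t * x) q"]
  by (simp add: qtheta_list_def scale_list_def o_def)

lemma qtheta_list_scale_step_down:
  assumes "norm q < 1" "q \<noteq> 0" "t \<noteq> 0" "\<forall>k<length xs. xs ! k \<noteq> 0"
  shows "qtheta_list (scale_list (t / q) xs) q =
    (- (t / q)) ^ length xs * prod_list xs * qtheta_list (scale_list t xs) q"
proof -
  have "qtheta (t / q * xs ! k) q = (- (t / q)) * xs ! k * qtheta (t * xs ! k) q" if "k < length xs" for k
    using qtheta_step_down[OF assms(1,2), of "t * xs ! k"] that assms(3,4) by simp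
  then have "qtheta_list (scale_list (t / q) xs) q =
      (\<Prod>k<length xs. (- (t / q)) * xs ! k * qtheta (t * xs ! k) q)"
    unfolding qtheta_list_scale by (intro prod.cong) auto
  also have "\<dots> = (- (t / q)) ^ length xs * (\<Prod>k<length xs. xs ! k) * qtheta_list (scale_list t xs) q"
    by (simp only: prod.distrib qtheta_list_scale prod_constant card_lessThan)
  also have "(\<Prod>k<length xs. xs ! k) = prod_list xs"
    by (simp add: prod.list_conv_set_nth atLeast0LessThan)
  finally show ?thesis .
qed

lemma holomorphic_on_qtheta [holomorphic_intros]:
  assumes "norm q < 1" "g holomorphic_on S" "\<And>w. w \<in> S \<Longrightarrow> g w \<noteq> 0"
  shows "(\<lambda>w. qtheta (g w) q) holomorphic_on S"
  unfolding qtheta_def using assms by (intro holomorphic_intros) auto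

lemma qpoch_list_pair_eq_qtheta_list:
  "qpoch_list (scale_list t xs) q * qpoch_list (scale_list (1 / t) (recip_list q xs)) q = qtheta_list (scale_list t xs) q"
  by (induction xs) (simp_all add: qpoch_list_def scale_list_def recip_list_def qtheta_list_def qtheta_def mult_ac)

section \<open>Means over circles and their dilations\<close>

text \<open>The mean is taken with respect to \<open>dw / w\<close>, which is invariant under \<open>w \<mapsto> c w\<close>. A change of the
  circle can thus be expressed as a change of the integrand, with the circle kept fixed.\<close>

definition circle_mean :: "real \<Rightarrow> (complex \<Rightarrow> complex) \<Rightarrow> complex" where
  "circle_mean r F = contour_integral (circlepath 0 r) (\<lambda>w. F w / w) / (2 * of_real pi * \<i>)"

lemma has_contour_integral_circle_mean:
  assumes "0 < r" "continuous_on (sphere 0 r) F"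
  shows "((\<lambda>w. F w / w) has_contour_integral 2 * of_real pi * \<i> * circle_mean r F) (circlepath 0 r)"
proof -
  have "continuous_on (path_image (circlepath 0 r)) (\<lambda>w. F w / w)"
    using assms by (auto intro!: continuous_intros)
  from has_contour_integral_integral[OF contour_integrable_continuous_circlepath[OF this]]
  show ?thesis
    by (simp add: circle_mean_def)
qed

lemma circle_mean_unique:
  assumes "((\<lambda>w. F w / w) has_contour_integral 2 * of_real pi * \<i> * I) (circlepath 0 r)"
  shows "circle_mean r F = I"
  using contour_integral_unique[OF assms] by (simp add: circle_mean_def)

lemma circle_mean_cong:
  assumes "0 < r" "\<And>w. norm w = r \<Longrightarrow> F w = G w"
  shows "circle_mean r F = circle_mean r G"
  unfolding circle_mean_def using assms by (intro arg_cong2[where f = "(/)"] contour_integral_cong) auto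

lemma circle_mean_lincomb:
  assumes "0 < r" "finite S" "\<And>i. i \<in> S \<Longrightarrow> continuous_on (sphere 0 r) (F i)"
  shows "circle_mean r (\<lambda>w. \<Sum>i\<in>S. c i * F i w) = (\<Sum>i\<in>S. c i * circle_mean r (F i))"
proof (rule circle_mean_unique)
  have "((\<lambda>w. \<Sum>i\<in>S. c i * (F i w / w)) has_contour_integral
      (\<Sum>i\<in>S. c i * (2 * of_real pi * \<i> * circle_mean r (F i)))) (circlepath 0 r)"
    using assms
    by (intro has_contour_integral_sum has_contour_integral_lmul has_contour_integral_circle_mean) auto
  then show "((\<lambda>w. (\<Sum>i\<in>S. c i * F i w) / w) has_contour_integral
      2 * of_real pi * \<i> * (\<Sum>i\<in>S. c i * circle_mean r (F i))) (circlepath 0 r)"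
    by (simp add: sum_divide_distrib sum_distrib_left mult_ac)
qed

lemma circle_mean_cmult:
  assumes "0 < r" "continuous_on (sphere 0 r) F"
  shows "circle_mean r (\<lambda>w. c * F w) = c * circle_mean r F"
  using circle_mean_lincomb[of r "{()}" "\<lambda>_. F" "\<lambda>_. c"] assms by simp

lemma circle_mean_add:
  assumes "0 < r" "continuous_on (sphere 0 r) F" "continuous_on (sphere 0 r) G"
  shows "circle_mean r (\<lambda>w. F w + G w) = circle_mean r F + circle_mean r G"
  using circle_mean_lincomb[of r "UNIV :: bool set" "\<lambda>i. if i then F else G" "\<lambda>_. 1"] assms
  by (simp add: UNIV_bool add.commute)

lemma circle_mean_bound:
  assumes "0 < r" "continuous_on (sphere 0 r) F" "\<And>w. norm w = r \<Longrightarrow> norm (F w) \<le> M"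
  shows "norm (circle_mean r F) \<le> M"
proof -
  have "norm (F (of_real r)) \<le> M"
    using assms by simp
  then have "0 \<le> M"
    using norm_ge_zero order_trans by blast
  have "norm (2 * of_real pi * \<i> * circle_mean r F) \<le> (M / r) * (2 * pi * r)"
    using assms \<open>0 \<le> M\<close>
    by (intro has_contour_integral_bound_circlepath[OF has_contour_integral_circle_mean])
       (auto simp: norm_divide divide_right_mono)
  then show ?thesis
    using assms(1) by (simp add: norm_mult)
qed

lemma contour_integral_scaled_circle:
  "contour_integral (\<lambda>t. c * circlepath 0 r t) f = contour_integral (circlepath 0 r) (\<lambda>w. c * f (c * w))"
proof -
  have "vector_derivative (\<lambda>t. c * circlepath 0 r t) (at t) = c * vector_derivative (circlepath 0 r) (at t)" for t
    unfolding vector_derivative_circlepath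
    by (intro vector_derivative_at has_vector_derivative_mult_right has_vector_derivative_circlepath)
  then show ?thesis
    by (simp add: contour_integral_integral mult_ac)
qed

text \<open>The loops \<open>\<gamma>\<close> and \<open>c \<cdot> \<gamma>\<close> are homotopic through the logarithmic spirals \<open>c powr s \<cdot> \<gamma>\<close>,
  which stay in the closed annulus between the two circles. Allowing complex \<open>c\<close> covers rotations
  (\<open>norm c = 1\<close>) as well as the dilation by \<open>1 / q\<close> for a complex \<open>q\<close>.\<close>

lemma circle_mean_dilate:
  assumes "0 < r" "c \<noteq> 0" "open S" "F holomorphic_on S"
    and sub: "\<And>w. min r (norm c * r) \<le> norm w \<Longrightarrow> norm w \<le> max r (norm c * r) \<Longrightarrow> w \<in> S"
  shows "circle_mean r (\<lambda>w. F (c * w)) = circle_mean r F"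
proof -
  define T where "T = S - {0}"
  define h where "h = (\<lambda>y. exp (of_real (fst y) * Ln c) * circlepath 0 r (snd y) :: complex)"
  have norm_h: "min r (norm c * r) \<le> norm (h y) \<and> norm (h y) \<le> max r (norm c * r) \<and> h y \<noteq> 0"
    if "fst y \<in> {0..1}" for y
  proof -
    define s where "s = fst y"
    have "norm (circlepath 0 r (snd y)) = r"
      using assms(1) by (simp add: circlepath norm_mult)
    then have nh: "norm (h y) = exp (s * ln (norm c)) * r"
      using assms(2) by (simp add: h_def norm_mult s_def)
    have ec: "exp (ln (norm c)) = norm c"
      using assms(2) by simp
    \<comment> \<open>The exponential is the modulus of \<open>c powr s\<close>, which lies between 1 and \<open>norm c\<close> for \<open>s\<close> in the unit interval.\<close>
    have "min 1 (norm c) \<le> exp (s * ln (norm c)) \<and> exp (s * ln (norm c)) \<le> max 1 (norm c)"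
    proof (cases "norm c \<le> 1")
      case True
      then have "ln (norm c) \<le> s * ln (norm c)" "s * ln (norm c) \<le> 0"
        using that assms(2) mult_right_mono_neg[of s 1 "ln (norm c)"]
        by (auto simp: s_def mult_nonneg_nonpos)
      then have "norm c \<le> exp (s * ln (norm c))" "exp (s * ln (norm c)) \<le> 1"
        by (metis ec exp_le_cancel_iff, simp)
      then show ?thesis
        using True by (simp only: min_absorb2 max_absorb1)
    next
      case False
      then have "s * ln (norm c) \<le> ln (norm c)" "0 \<le> s * ln (norm c)"
        using that assms(2) mult_right_mono[of s 1 "ln (norm c)"]
        by (auto simp: s_def)
      then have "exp (s * ln (norm c)) \<le> norm c" "1 \<le> exp (s * ln (norm c))"
        by (metis ec exp_le_cancel_iff, simp)
      then show ?thesis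
        using False by (simp only: min_absorb1 max_absorb2)
    qed
    then have "min 1 (norm c) * r \<le> norm (h y)" "norm (h y) \<le> max 1 (norm c) * r"
      using assms(1) by (auto simp: nh)
    moreover have "norm (h y) \<noteq> 0"
      using nh assms(1) by simp
    ultimately show ?thesis
      using assms(1) by (auto simp: min_mult_distrib_right max_mult_distrib_right)
  qed
  have "homotopic_loops T (circlepath 0 r) (\<lambda>t. c * circlepath 0 r t)"
    unfolding homotopic_loops
  proof (intro exI[of _ h] conjI ballI)
    show "continuous_on ({0..1} \<times> {0..1}) h"
      unfolding h_def circlepath by (intro continuous_intros)
    show "h \<in> {0..1} \<times> {0..1} \<rightarrow> T"
      using norm_h sub by (auto simp: T_def)
    show "pathfinish (h \<circ> Pair t) = pathstart (h \<circ> Pair t)" for t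
      by (simp add: h_def pathfinish_def pathstart_def circlepath)
  qed (use assms(2) in \<open>simp_all add: h_def\<close>)
  moreover have "valid_path (\<lambda>t. c * circlepath 0 r t)"
    using valid_path_compose_holomorphic[of "circlepath 0 r" "\<lambda>w. c * w" UNIV]
    by (auto simp: o_def intro!: holomorphic_intros)
  moreover have "(\<lambda>w. F w / w) holomorphic_on T"
    unfolding T_def using assms(4) by (auto intro!: holomorphic_intros intro: holomorphic_on_subset)
  moreover have "open T"
    unfolding T_def using assms(3) by (simp add: open_delete)
  ultimately have "contour_integral (circlepath 0 r) (\<lambda>w. F w / w) =
      contour_integral (\<lambda>t. c * circlepath 0 r t) (\<lambda>w. F w / w)"
    by (intro Cauchy_theorem_homotopic_loops) auto
  also have "\<dots> = contour_integral (circlepath 0 r) (\<lambda>w. F (c * w) / w)"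
    unfolding contour_integral_scaled_circle using assms(2) by simp
  finally show ?thesis
    by (simp add: circle_mean_def)
qed

lemma circle_mean_pole_outside:
  assumes "0 < r" "r < norm a"
  shows "circle_mean r (\<lambda>w. 1 / (w - a)) = - 1 / a"
proof (rule circle_mean_unique)
  have "((\<lambda>w. (1 / (w - a)) / (w - 0)) has_contour_integral 2 * of_real pi * \<i> * (1 / (0 - a))) (circlepath 0 r)"
    using assms by (intro Cauchy_integral_circlepath_simple) (auto intro!: holomorphic_intros)
  then show "((\<lambda>w. 1 / (w - a) / w) has_contour_integral 2 * of_real pi * \<i> * (- 1 / a)) (circlepath 0 r)"
    by simp
qed

text \<open>The integrand \<open>1 / (c * w - a) / w\<close> has two poles in the disc, at \<open>0\<close> and \<open>a / c\<close>, with opposite residues.\<close>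

lemma circle_mean_pole_inside:
  assumes "0 < r" "norm a < norm c * r" "a \<noteq> 0"
  shows "circle_mean r (\<lambda>w. 1 / (c * w - a)) = 0"
proof (rule circle_mean_unique)
  have c: "c \<noteq> 0"
    using assms by auto
  have a: "norm (a / c) < r"
    using assms c by (simp add: norm_divide field_simps)
  have "((\<lambda>w. (1 / a) / (w - a / c) - (1 / a) / (w - 0)) has_contour_integral
      2 * of_real pi * \<i> * (1 / a) - 2 * of_real pi * \<i> * (1 / a)) (circlepath 0 r)"
    using assms(1) a
    by (intro has_contour_integral_diff Cauchy_integral_circlepath_simple) (auto intro!: holomorphic_intros)
  then have int: "((\<lambda>w. (1 / a) / (w - a / c) - (1 / a) / (w - 0)) has_contour_integral 2 * of_real pi * \<i> * 0) (circlepath 0 r)"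
    by simp
  have eq: "(1 / a) / (w - a / c) - (1 / a) / (w - 0) = 1 / (c * w - a) / w"
    if "w \<in> path_image (circlepath 0 r)" for w
  proof -
    have w: "w \<noteq> 0" "norm w = r"
      using that assms(1) by auto
    then have "c * w \<noteq> a"
      using assms(2) by (auto simp: norm_mult)
    then show ?thesis
      using w(1) c assms(3) by (simp add: divide_simps) (simp add: algebra_simps)
  qed
  show "((\<lambda>w. 1 / (c * w - a) / w) has_contour_integral 2 * of_real pi * \<i> * 0) (circlepath 0 r)"
    by (rule has_contour_integral_eq[OF int eq])
qed

text \<open>Splitting \<open>H w / (w - a)\<close> into its principal part and a holomorphic function \<open>G\<close> leaves the mean of
  \<open>G\<close> unchanged under dilation, while the mean of the principal part jumps by \<open>H a / a\<close>.\<close>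

lemma circle_mean_dilate_pole:
  assumes "0 < r" "open S" "H holomorphic_on S"
    and sub: "\<And>w. r \<le> norm w \<Longrightarrow> norm w \<le> norm c * r \<Longrightarrow> w \<in> S"
    and a: "r < norm a" "norm a < norm c * r"
  shows "circle_mean r (\<lambda>w. H (c * w) / (c * w - a)) = circle_mean r (\<lambda>w. H w / (w - a)) + H a / a"
proof -
  define G where "G = (\<lambda>w. if w = a then deriv H a else (H w - H a) / (w - a))"
  have holG: "G holomorphic_on S"
    unfolding G_def using assms by (intro pole_lemma_open) auto
  have "c \<noteq> 0" "a \<noteq> 0"
    using assms(1) a by auto
  have c: "1 \<le> norm c"
    using assms(1) a by (smt (verit) mult_right_le_one_le norm_ge_zero mult.commute)
  have contG: "continuous_on S G"
    using holG holomorphic_on_imp_continuous_on by blast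
  have inS: "w \<in> S \<and> c * w \<in> S" if "norm w = r" for w
    using that sub c assms(1) by (auto simp: norm_mult)
  have ne: "w \<noteq> a" "c * w \<noteq> a" if "norm w = r" for w
    using that a by (auto simp: norm_mult)
  have cont1: "continuous_on (sphere 0 r) G"
    by (rule continuous_on_subset[OF contG]) (use inS in auto)
  have cont2: "continuous_on (sphere 0 r) (\<lambda>w. G (c * w))"
    by (rule continuous_on_compose2[OF contG]) (use inS in \<open>auto intro!: continuous_intros\<close>)
  have contp1: "continuous_on (sphere 0 r) (\<lambda>w. 1 / (w - a))"
    using ne by (auto intro!: continuous_intros)
  have contp2: "continuous_on (sphere 0 r) (\<lambda>w. 1 / (c * w - a))"
    using ne by (auto intro!: continuous_intros)
  have split: "H w / (w - a) = G w + H a * (1 / (w - a))" if "w \<noteq> a" for w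
    using that by (simp add: G_def diff_divide_distrib)
  have "circle_mean r (\<lambda>w. H (c * w) / (c * w - a)) =
      circle_mean r (\<lambda>w. G (c * w) + H a * (1 / (c * w - a)))"
    by (rule circle_mean_cong[OF assms(1)], rule split, use ne in auto)
  also have "\<dots> = circle_mean r (\<lambda>w. G (c * w)) + circle_mean r (\<lambda>w. H a * (1 / (c * w - a)))"
    by (intro circle_mean_add assms(1) cont2 continuous_on_mult_left contp2)
  also have "circle_mean r (\<lambda>w. H a * (1 / (c * w - a))) = 0"
    unfolding circle_mean_cmult[OF assms(1) contp2] circle_mean_pole_inside[OF assms(1) a(2) \<open>a \<noteq> 0\<close>]
    by simp
  also have "circle_mean r (\<lambda>w. G (c * w)) + 0 = circle_mean r (\<lambda>w. G (c * w))"
    by simp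
  also have "\<dots> = circle_mean r G"
    using assms(1,2) \<open>c \<noteq> 0\<close> holG sub c by (intro circle_mean_dilate[of r c S]) auto
  finally have 1: "circle_mean r (\<lambda>w. H (c * w) / (c * w - a)) = circle_mean r G" .
  have "circle_mean r (\<lambda>w. H w / (w - a)) = circle_mean r (\<lambda>w. G w + H a * (1 / (w - a)))"
    by (rule circle_mean_cong[OF assms(1)], rule split, use ne in auto)
  also have "\<dots> = circle_mean r G + circle_mean r (\<lambda>w. H a * (1 / (w - a)))"
    by (intro circle_mean_add assms(1) cont1 continuous_on_mult_left contp1)
  also have "circle_mean r (\<lambda>w. H a * (1 / (w - a))) = - H a / a"
    unfolding circle_mean_cmult[OF assms(1) contp1] circle_mean_pole_outside[OF assms(1) a(1)]
    by simp
  finally show ?thesis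
    using 1 by simp
qed

lemma partial_fractions_two_poles:
  fixes u v :: "'a::field"
  assumes "u \<noteq> 0" "v \<noteq> 0" "u \<noteq> v"
  shows "1 / u / v = 1 / (v - u) / u + 1 / (u - v) / v"
proof -
  have "1 / (u - v) = - (1 / (v - u))"
    by (metis minus_diff_eq minus_divide_right)
  then have "1 / (v - u) / u + 1 / (u - v) / v = 1 / (v - u) * (1 / u - 1 / v)"
    by (simp add: right_diff_distrib)
  also have "1 / u - 1 / v = (v - u) / (u * v)"
    using assms(1,2) by (simp add: diff_frac_eq)
  also have "1 / (v - u) * ((v - u) / (u * v)) = 1 / u / v"
    using assms(3) by simp
  finally show ?thesis ..
qed

text \<open>In the induction step the coefficient of the new pole \<open>a k\<close> is found by the same formula for the
  smaller index set, evaluated at \<open>w = a k\<close>.\<close>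

lemma partial_fractions_simple_poles:
  fixes a :: "'i \<Rightarrow> 'a::field"
  assumes "finite I" "I \<noteq> {}" "inj_on a I" "\<And>i. i \<in> I \<Longrightarrow> w \<noteq> a i"
  shows "1 / (\<Prod>i\<in>I. w - a i) = (\<Sum>i\<in>I. 1 / (\<Prod>j\<in>I - {i}. a i - a j) / (w - a i))"
  using assms
proof (induction I arbitrary: w rule: finite_ne_induct)
  case (insert k I)
  define P where "P = (\<lambda>i. \<Prod>j\<in>I - {i}. a i - a j)"
  have inj: "inj_on a I"
    using insert.prems(1) by simp
  have ki: "a k \<noteq> a i" if "i \<in> I" for i
    using insert.prems(1) insert.hyps(3) that by (auto simp: inj_on_def)
  have IH: "1 / (\<Prod>i\<in>I. v - a i) = (\<Sum>i\<in>I. 1 / P i / (v - a i))" if "\<And>i. i \<in> I \<Longrightarrow> v \<noteq> a i" for v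
    unfolding P_def using inj that by (rule insert.IH)
  have P: "(\<Prod>j\<in>insert k I - {i}. a i - a j) = (a i - a k) * P i" if "i \<in> I" for i
  proof -
    have "insert k I - {i} = insert k (I - {i})"
      using insert.hyps(3) that by auto
    then show ?thesis
      using insert.hyps by (simp add: P_def)
  qed
  have "1 / (\<Prod>i\<in>insert k I. w - a i) = 1 / (\<Prod>i\<in>I. w - a i) / (w - a k)"
    using insert.hyps by (simp add: mult.commute)
  also have "\<dots> = (\<Sum>i\<in>I. 1 / P i / (w - a i)) / (w - a k)"
    by (subst IH) (use insert.prems(2) in auto)
  also have "\<dots> = (\<Sum>i\<in>I. 1 / ((a i - a k) * P i) / (w - a i) + (1 / P i / (a k - a i)) / (w - a k))"
    unfolding sum_divide_distrib
  proof (rule sum.cong)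
    fix i assume i: "i \<in> I"
    have "1 / (w - a i) / (w - a k) = 1 / ((w - a k) - (w - a i)) / (w - a i) + 1 / ((w - a i) - (w - a k)) / (w - a k)"
      by (rule partial_fractions_two_poles) (use insert.prems(2) ki[OF i] i in auto)
    then have eq: "1 / (w - a i) / (w - a k) = 1 / (a i - a k) / (w - a i) + 1 / (a k - a i) / (w - a k)"
      by (simp only: diff_diff_eq2 diff_add_cancel add_diff_cancel_left' add_diff_cancel_right' diff_diff_eq) simp
    have "1 / P i / (w - a i) / (w - a k) = 1 / P i * (1 / (w - a i) / (w - a k))"
      by simp
    also have "\<dots> = 1 / P i * (1 / (a i - a k) / (w - a i) + 1 / (a k - a i) / (w - a k))"
      by (simp only: eq)
    also have "\<dots> = 1 / ((a i - a k) * P i) / (w - a i) + (1 / P i / (a k - a i)) / (w - a k)"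
      by (simp add: distrib_left mult_ac)
    finally show "1 / P i / (w - a i) / (w - a k) =
        1 / ((a i - a k) * P i) / (w - a i) + (1 / P i / (a k - a i)) / (w - a k)" .
  qed simp
  also have "\<dots> = (\<Sum>i\<in>I. 1 / ((a i - a k) * P i) / (w - a i)) + (\<Sum>i\<in>I. 1 / P i / (a k - a i)) / (w - a k)"
    by (simp only: sum.distrib sum_divide_distrib)
  also have "(\<Sum>i\<in>I. 1 / P i / (a k - a i)) = 1 / (\<Prod>i\<in>I. a k - a i)"
    using IH[OF ki] ..
  also have "(\<Prod>i\<in>I. a k - a i) = (\<Prod>i\<in>insert k I - {k}. a k - a i)"
    using insert.hyps(3) by simp
  also have "(\<Sum>i\<in>I. 1 / ((a i - a k) * P i) / (w - a i)) =
      (\<Sum>i\<in>I. 1 / (\<Prod>j\<in>insert k I - {i}. a i - a j) / (w - a i))"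
    by (intro sum.cong refl) (simp only: P)
  finally show ?case
    using insert.hyps by (simp only: sum.insert add.commute not_False_eq_True)
qed simp

text \<open>The residue theorem for an annulus with finitely many simple poles, in the form of a comparison of
  two integrands on one circle.\<close>

lemma circle_mean_dilate_simple_poles:
  assumes "0 < r" "open S" "H holomorphic_on S"
    and sub: "\<And>w. r \<le> norm w \<Longrightarrow> norm w \<le> norm c * r \<Longrightarrow> w \<in> S"
    and I: "finite I" "I \<noteq> {}" "inj_on a I"
    and a: "\<And>i. i \<in> I \<Longrightarrow> r < norm (a i) \<and> norm (a i) < norm c * r"
  shows "circle_mean r (\<lambda>w. H (c * w) / (\<Prod>i\<in>I. c * w - a i)) =
    circle_mean r (\<lambda>w. H w / (\<Prod>i\<in>I. w - a i)) + (\<Sum>i\<in>I. H (a i) / (a i * (\<Prod>j\<in>I - {i}. a i - a j)))"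
proof -
  define P where "P = (\<lambda>i. 1 / (\<Prod>j\<in>I - {i}. a i - a j))"
  obtain i0 where "i0 \<in> I"
    using I by blast
  have c: "1 \<le> norm c"
    using assms(1) a[OF \<open>i0 \<in> I\<close>] by (smt (verit) mult_right_le_one_le norm_ge_zero mult.commute)
  have contH: "continuous_on S H"
    using assms(3) holomorphic_on_imp_continuous_on by blast
  have inS: "w \<in> S \<and> c * w \<in> S" if "norm w = r" for w
    using that sub c assms(1) by (auto simp: norm_mult)
  have ne: "w \<noteq> a i" "c * w \<noteq> a i" if "norm w = r" "i \<in> I" for w i
    using that a[OF that(2)] norm_mult[of c w] by fastforce+
  have split: "H w / (\<Prod>i\<in>I. w - a i) = (\<Sum>i\<in>I. P i * (H w / (w - a i)))" if "\<And>i. i \<in> I \<Longrightarrow> w \<noteq> a i" for w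
  proof -
    have pf: "1 / (\<Prod>i\<in>I. w - a i) = (\<Sum>i\<in>I. P i / (w - a i))"
      unfolding P_def using I that by (rule partial_fractions_simple_poles)
    have "H w / (\<Prod>i\<in>I. w - a i) = H w * (1 / (\<Prod>i\<in>I. w - a i))"
      by simp
    also have "\<dots> = (\<Sum>i\<in>I. H w * (P i / (w - a i)))"
      by (simp only: pf sum_distrib_left)
    finally show ?thesis
      by (simp add: mult.commute)
  qed
  have cont1: "continuous_on (sphere 0 r) (\<lambda>w. H w / (w - a i))" if "i \<in> I" for i
    using ne that inS by (auto intro!: continuous_intros continuous_on_subset[OF contH])
  have cont2: "continuous_on (sphere 0 r) (\<lambda>w. H (c * w) / (c * w - a i))" if "i \<in> I" for i
    using ne that inS by (auto intro!: continuous_intros continuous_on_compose2[OF contH])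
  have "circle_mean r (\<lambda>w. H (c * w) / (\<Prod>i\<in>I. c * w - a i)) =
      circle_mean r (\<lambda>w. \<Sum>i\<in>I. P i * (H (c * w) / (c * w - a i)))"
    by (intro circle_mean_cong assms(1) split) (use ne in auto)
  also have "\<dots> = (\<Sum>i\<in>I. P i * circle_mean r (\<lambda>w. H (c * w) / (c * w - a i)))"
    by (intro circle_mean_lincomb assms(1) I cont2)
  also have "\<dots> = (\<Sum>i\<in>I. P i * (circle_mean r (\<lambda>w. H w / (w - a i)) + H (a i) / a i))"
    using a by (intro sum.cong refl arg_cong2[where f = "(*)"] circle_mean_dilate_pole[of r S]) (use assms in auto)
  also have "\<dots> = (\<Sum>i\<in>I. P i * circle_mean r (\<lambda>w. H w / (w - a i))) + (\<Sum>i\<in>I. H (a i) / (a i * (\<Prod>j\<in>I - {i}. a i - a j)))"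
    by (simp add: distrib_left sum.distrib P_def mult.commute)
  also have "(\<Sum>i\<in>I. P i * circle_mean r (\<lambda>w. H w / (w - a i))) = circle_mean r (\<lambda>w. \<Sum>i\<in>I. P i * (H w / (w - a i)))"
    by (intro circle_mean_lincomb[symmetric] assms(1) I cont1)
  also have "\<dots> = circle_mean r (\<lambda>w. H w / (\<Prod>i\<in>I. w - a i))"
    by (intro circle_mean_cong assms(1) split[symmetric]) (use ne in auto)
  finally show ?thesis .
qed

text \<open>The substitution \<open>\<psi> = pi - t\<close> reverses the orientation and starts the circle at \<open>-r\<close> instead of \<open>r\<close>;
  the latter is undone by the rotation \<open>w \<mapsto> -w\<close>, which is a dilation with \<open>c = -1\<close>.\<close>

lemma has_integral_circle_mean:
  assumes "0 < r" "open S" "F holomorphic_on S" "sphere 0 r \<subseteq> S"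
  shows "((\<lambda>\<psi>. F (of_real r / cis \<psi>)) has_integral 2 * of_real pi * circle_mean r F) {-pi..pi}"
proof -
  have cont: "continuous_on (sphere 0 r) (\<lambda>w. F (- w))"
    using holomorphic_on_imp_continuous_on[OF assms(3)] assms(4)
    by (auto intro!: continuous_on_compose2[of S F] continuous_intros)
  have "circle_mean r (\<lambda>w. F (- w)) = circle_mean r F"
    using circle_mean_dilate[of r "-1" S F] assms by (auto simp: subset_eq)
  then have "((\<lambda>w. F (- w) / w) has_contour_integral 2 * of_real pi * \<i> * circle_mean r F) (circlepath 0 r)"
    using has_contour_integral_circle_mean[OF assms(1) cont] by simp
  then have "((\<lambda>t. F (- (r * cis t)) / (r * cis t) * r * \<i> * cis t) has_integral
      2 * of_real pi * \<i> * circle_mean r F) {0..2 * pi}"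
    unfolding circlepath_def by (subst (asm) has_contour_integral_part_circlepath_iff) auto
  then have "((\<lambda>t. (1 / \<i>) * (F (- (r * cis t)) / (r * cis t) * r * \<i> * cis t)) has_integral
      (1 / \<i>) * (2 * of_real pi * \<i> * circle_mean r F)) (cbox 0 (2 * pi))"
    by (intro has_integral_mult_right) simp
  then have "((\<lambda>t. F (- (r * cis t))) has_integral 2 * of_real pi * circle_mean r F) (cbox 0 (2 * pi))"
  proof (rule has_integral_eq_rhs[OF has_integral_eq[rotated]])
    show "(1 / \<i>) * (F (- (r * cis t)) / (r * cis t) * r * \<i> * cis t) = F (- (r * cis t))" for t
      using assms(1) by (simp add: field_simps)
  qed simp
  from has_integral_affinity[OF this, of "-1" pi]
  have "((\<lambda>\<psi>. F (- (r * cis (- \<psi> + pi)))) has_integral 2 * of_real pi * circle_mean r F) ((\<lambda>x. pi - x) ` {0..2 * pi})"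
    by simp
  moreover have "(\<lambda>x. pi - x) ` {0..2 * pi} = {-pi..pi}"
    by simp
  moreover have "- (r * cis (- \<psi> + pi)) = of_real r / cis \<psi>" for \<psi>
  proof -
    have "cis (- \<psi> + pi) = cis (- \<psi>) * cis pi"
      by (simp only: cis_mult)
    then show ?thesis
      by (simp add: divide_inverse cis_inverse)
  qed
  ultimately show ?thesis
    by simp
qed

section \<open>The series in the evaluation\<close>

definition Phi_term :: "complex \<Rightarrow> nat \<Rightarrow> complex \<Rightarrow> nat \<Rightarrow> complex" where
  "Phi_term q p x n = ((-1) ^ n * q ^ (n choose 2)) ^ p * x ^ n"

lemma Phi_term_0 [simp]: "Phi_term q p x 0 = 1"
  by (simp add: Phi_term_def numeral_2_eq_2)

lemma Phi_term_Suc: "Phi_term q p x (Suc n) = (-1) ^ p * x * (q ^ p) ^ n * Phi_term q p x n"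
proof -
  have "Suc n choose 2 = n + (n choose 2)"
    by (simp add: numeral_2_eq_2)
  then have "(-1) ^ Suc n * q ^ (Suc n choose 2) = (-1) * q ^ n * ((-1) ^ n * q ^ (n choose 2))"
    by (simp add: power_add)
  moreover have "(q ^ n) ^ p = (q ^ p) ^ n"
    by (simp add: mult.commute flip: power_mult)
  ultimately show ?thesis
    unfolding Phi_term_def by (simp only: power_mult_distrib power_Suc mult_ac)
qed

text \<open>For \<open>p > 0\<close> the quotients of consecutive terms tend to 0, whatever \<open>x\<close> is; for \<open>p = 0\<close> the series is
  geometric.\<close>

lemma summable_Phi_term:
  assumes "norm q < 1" "p = 0 \<Longrightarrow> norm x < 1"
  shows "summable (Phi_term q p x)"
proof (cases "p = 0")
  case True
  then have "Phi_term q p x = (\<lambda>n. x ^ n)"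
    by (simp add: fun_eq_iff Phi_term_def)
  then show ?thesis
    using assms(2)[OF True] by (simp add: summable_geometric)
next
  case False
  have "norm (q ^ p) < 1"
    using assms(1) False by (simp add: norm_power power_less_one_iff)
  then have "(\<lambda>n. norm x * norm (q ^ p) ^ n) \<longlonglongrightarrow> norm x * 0"
    by (intro tendsto_intros LIMSEQ_power_zero) simp
  then have "eventually (\<lambda>n. norm x * norm (q ^ p) ^ n < 1 / 2) sequentially"
    by (rule order_tendstoD) simp
  then obtain N where N: "norm x * norm (q ^ p) ^ n < 1 / 2" if "n \<ge> N" for n
    by (auto simp: eventually_sequentially)
  show ?thesis
  proof (rule summable_ratio_test)
    show "norm (Phi_term q p x (Suc n)) \<le> 1 / 2 * norm (Phi_term q p x n)" if "n \<ge> N" for n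
      using mult_right_mono[OF less_imp_le[OF N[OF that]], of "norm (Phi_term q p x n)"]
      by (simp add: Phi_term_Suc norm_mult norm_power)
  qed simp
qed

lemma Phi_sums:
  assumes "norm q < 1" "p = 0 \<Longrightarrow> norm x < 1"
  shows "Phi_term q p x sums Phi q p x"
proof -
  have "summable (Phi_term q p x)"
    using assms by (rule summable_Phi_term)
  then show ?thesis
    by (simp add: Phi_def Phi_term_def[abs_def] summable_sums)
qed

lemma Phi_0:
  assumes "norm x < 1"
  shows "Phi q 0 x = 1 / (1 - x)"
  using suminf_geometric[OF assms] by (simp add: Phi_def)

text \<open>Raising the sign \<open>(-1) ^ n\<close> to the power \<open>p\<close> amounts to multiplying \<open>x\<close> by \<open>(-1) ^ p\<close>. The
  product in front cancels the normalisation of the partial theta function, hence has to be nonzero.\<close>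

lemma Phi_eq_partial_theta:
  assumes "norm q < 1" "0 < p"
  shows "Phi q p x = qpoch (q ^ p) (q ^ p) * partial_theta (- ((-1) ^ p * x)) (q ^ p)"
proof -
  have "norm (q ^ p) < 1"
    using assms by (simp add: norm_power power_less_one_iff)
  then have "qpoch (q ^ p) (q ^ p) \<noteq> 0"
    by (intro qpoch_nonzero)
  moreover have "(-1) ^ n * (q ^ p) ^ (n choose 2) * (- ((-1) ^ p * x)) ^ n =
      ((-1) ^ n * q ^ (n choose 2)) ^ p * x ^ n" for n
  proof -
    have neg: "(-1) ^ n * (- y) ^ n = y ^ n" for y :: complex
      by (simp flip: power_mult_distrib)
    have "(-1) ^ n * (q ^ p) ^ (n choose 2) * (- ((-1) ^ p * x)) ^ n =
        (q ^ p) ^ (n choose 2) * ((-1) ^ n * (- ((-1) ^ p * x)) ^ n)"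
      by (simp only: mult_ac)
    also have "\<dots> = (q ^ p) ^ (n choose 2) * ((-1) ^ p * x) ^ n"
      by (simp only: neg)
    finally have "(-1) ^ n * (q ^ p) ^ (n choose 2) * (- ((-1) ^ p * x)) ^ n =
        (q ^ p) ^ (n choose 2) * ((-1) ^ p * x) ^ n" .
    moreover have "((-1 :: complex) ^ p) ^ n = ((-1) ^ n) ^ p" "(q ^ p) ^ (n choose 2) = (q ^ (n choose 2)) ^ p"
      by (simp_all add: mult.commute flip: power_mult)
    ultimately show ?thesis
      by (simp only: power_mult_distrib mult_ac)
  qed
  ultimately show ?thesis
    by (simp add: Phi_def partial_theta_def)
qed

lemma power_int_add_mult:
  fixes y :: "'a::field"
  assumes "y \<noteq> 0"
  shows "y powi (m + int (k * i)) = y powi m * (y ^ k) ^ i"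
  using assms by (simp add: power_int_add power_mult del: of_nat_mult)

section \<open>The moments of a quotient of theta functions\<close>

text \<open>The poles \<open>1 / d ! k\<close> of the quotient lie between the circles of radius \<open>\<sigma>\<close> and \<open>\<sigma> / norm q\<close>. Hence the
  quotient of two entries of \<open>d\<close> has a modulus strictly between \<open>norm q\<close> and \<open>1 / norm q\<close>, and it is a
  power of \<open>q\<close> only if the two entries are equal.\<close>

locale theta_quotient =
  fixes q :: complex and \<sigma> :: real and b d :: "complex list"
  assumes q_nz: "q \<noteq> 0" and q_lt: "norm q < 1" and \<sigma>_pos: "0 < \<sigma>"
    and d_nonempty: "d \<noteq> []" and length_le: "length b \<le> length d"
    and b_nz: "\<forall>j<length b. b ! j \<noteq> 0"
    and d_bounds: "\<And>k. k < length d \<Longrightarrow> norm q / \<sigma> < norm (d ! k) \<and> norm (d ! k) < 1 / \<sigma>"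
    and d_distinct: "distinct d"
begin

abbreviation "D \<equiv> length d"

abbreviation "p \<equiv> length d - length b"

definition ratio :: "complex \<Rightarrow> complex" where
  "ratio w = qtheta_list (scale_list w b) q / qtheta_list (scale_list w d) q"

definition moment :: "int \<Rightarrow> complex" where
  "moment n = circle_mean \<sigma> (\<lambda>w. ratio w * w powi (- n))"

text \<open>The square of \<open>qpoch q q\<close> comes from the factor of \<open>\<theta>(d ! k * w)\<close> that is left at \<open>w = 1 / d ! k\<close> once
  the vanishing factor is removed.\<close>

definition coeff :: "nat \<Rightarrow> complex" where
  "coeff k = qtheta_list (scale_list (1 / d ! k) b) q /
    (qtheta_list (scale_list (1 / d ! k) (drop_nth k d)) q * qpoch q q ^ 2)"

text \<open>The constant in the functional equation \<open>ratio (w / q) = \<kappa> * w powi (- p) * ratio w\<close>.\<close>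

definition \<kappa> :: complex where
  "\<kappa> = (- q) ^ p * (prod_list b / prod_list d)"

text \<open>A neighbourhood of the closed annulus between the radii \<open>\<sigma>\<close> and \<open>\<sigma> / norm q\<close>, small enough to
  exclude all poles but the \<open>1 / d ! k\<close>.\<close>

definition annulus :: "complex set" where
  "annulus = (\<Inter>k<D. {w. norm q < norm (w * d ! k) \<and> norm (w * d ! k) < 1 / norm q})"

text \<open>The numerator left when the poles \<open>1 / d ! k\<close> are split off from \<open>ratio w * w powi (- n)\<close>.\<close>

definition regular_part :: "int \<Rightarrow> complex \<Rightarrow> complex" where
  "regular_part n w = qtheta_list (scale_list w b) q * w powi (- n) /
    (\<Prod>k<D. - d ! k * (qpoch (q * (w * d ! k)) q * qpoch (q / (w * d ! k)) q))"

lemma d_nz: "k < D \<Longrightarrow> d ! k \<noteq> 0"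
  using d_bounds[of k] q_nz \<sigma>_pos
  by (metis divide_nonneg_pos norm_ge_zero norm_zero not_less)

lemma open_annulus: "open annulus"
  unfolding annulus_def
  by (intro open_INT ballI open_Collect_conj open_Collect_less continuous_intros finite_lessThan)

lemma annulus_nz: "w \<in> annulus \<Longrightarrow> w \<noteq> 0"
  using d_nonempty q_nz by (auto simp: annulus_def)

lemma closed_annulus_subset:
  assumes "\<sigma> \<le> norm w" "norm w \<le> norm (1 / q) * \<sigma>"
  shows "w \<in> annulus"
proof -
  have "norm q < norm w * norm (d ! k) \<and> norm w * norm (d ! k) < 1 / norm q" if "k < D" for k
  proof
    have "norm q < \<sigma> * norm (d ! k)"
      using d_bounds[OF that] \<sigma>_pos by (simp add: field_simps)
    also have "\<dots> \<le> norm w * norm (d ! k)"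
      using assms(1) by (simp add: mult_right_mono)
    finally show "norm q < norm w * norm (d ! k)" .
    have "norm w * norm (d ! k) \<le> \<sigma> / norm q * norm (d ! k)"
      using assms(2) by (intro mult_right_mono) (auto simp: norm_divide)
    also have "\<dots> < \<sigma> / norm q * (1 / \<sigma>)"
      using d_bounds[OF that] \<sigma>_pos q_nz by (intro mult_strict_left_mono) auto
    also have "\<dots> = 1 / norm q"
      using \<sigma>_pos by simp
    finally show "norm w * norm (d ! k) < 1 / norm q" .
  qed
  then show ?thesis
    by (simp add: annulus_def norm_mult)
qed

lemma regular_factor_nz:
  assumes "w \<in> annulus" "k < D"
  shows "qpoch (q * (w * d ! k)) q * qpoch (q / (w * d ! k)) q \<noteq> 0"
proof -
  have *: "norm q < norm (w * d ! k)" "norm (w * d ! k) < 1 / norm q"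
    using assms by (auto simp: annulus_def)
  have "norm (q * (w * d ! k)) < 1"
    using *(2) q_nz by (simp add: norm_mult field_simps)
  moreover have "norm (q / (w * d ! k)) < 1"
    using *(1) by (simp add: norm_divide) (smt (verit) norm_ge_zero divide_less_eq_1)
  ultimately show ?thesis
    using qpoch_nonzero[OF q_lt] by simp
qed

lemma holomorphic_regular_part: "regular_part n holomorphic_on annulus"
  unfolding regular_part_def qtheta_list_scale
  using annulus_nz regular_factor_nz b_nz d_nz q_lt
  by (intro holomorphic_intros) (auto simp: prod_zero_iff)

lemma ratio_eq_regular_part: "ratio w * w powi (- n) = regular_part n w / (\<Prod>k<D. w - 1 / d ! k)"
proof -
  have "qtheta (w * d ! k) q =
      (- d ! k * (qpoch (q * (w * d ! k)) q * qpoch (q / (w * d ! k)) q)) * (w - 1 / d ! k)" if "k < D" for k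
  proof -
    have "1 - w * d ! k = - d ! k * (w - 1 / d ! k)"
      using d_nz[OF that] by (simp add: field_simps)
    then show ?thesis
      by (simp add: qtheta_factor[OF q_lt, of "w * d ! k"])
  qed
  then have "qtheta_list (scale_list w d) q =
      (\<Prod>k<D. (- d ! k * (qpoch (q * (w * d ! k)) q * qpoch (q / (w * d ! k)) q)) * (w - 1 / d ! k))"
    unfolding qtheta_list_scale by (intro prod.cong) auto
  also have "\<dots> = (\<Prod>k<D. - d ! k * (qpoch (q * (w * d ! k)) q * qpoch (q / (w * d ! k)) q)) * (\<Prod>k<D. w - 1 / d ! k)"
    by (rule prod.distrib)
  finally show ?thesis
    by (simp add: ratio_def regular_part_def)
qed

lemma pole_location:
  assumes "k < D"
  shows "\<sigma> < norm (1 / d ! k)" "norm (1 / d ! k) < norm (1 / q) * \<sigma>"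
  using d_bounds[OF assms] d_nz[OF assms] q_nz \<sigma>_pos
  by (auto simp: norm_divide field_simps)

lemma inj_poles: "inj_on (\<lambda>k. 1 / d ! k) {..<D}"
  using d_distinct by (auto simp: inj_on_def nth_eq_iff_index_eq)

text \<open>The left-hand side is the jump of the mean caused by the pole \<open>1 / d ! k\<close>. The factors belonging to
  \<open>j \<noteq> k\<close> recombine to \<open>\<theta>(d ! j / d ! k)\<close>, and the one belonging to \<open>k\<close> is \<open>- d ! k * (qpoch q q)^2\<close>.\<close>

lemma residue_eq:
  assumes "k < D"
  shows "regular_part n (1 / d ! k) / (1 / d ! k * (\<Prod>j\<in>{..<D} - {k}. 1 / d ! k - 1 / d ! j)) = - (coeff k * d ! k powi n)"
proof -
  define w where "w = 1 / d ! k"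
  define g where "g = (\<lambda>j. - d ! j * (qpoch (q * (w * d ! j)) q * qpoch (q / (w * d ! j)) q))"
  have w: "w * d ! k = 1" "w \<noteq> 0"
    using d_nz[OF assms] by (auto simp: w_def)
  have gk: "g k = - d ! k * qpoch q q ^ 2"
    by (simp add: g_def w power2_eq_square)
  have "qtheta (w * d ! j) q = g j * (w - 1 / d ! j)" if "j < D" for j
  proof -
    have "1 - w * d ! j = - d ! j * (w - 1 / d ! j)"
      using d_nz[OF that] by (simp add: field_simps)
    then show ?thesis
      by (simp add: qtheta_factor[OF q_lt, of "w * d ! j"] g_def)
  qed
  then have "qtheta_list (scale_list w (drop_nth k d)) q = (\<Prod>j\<in>{..<D} - {k}. g j * (w - 1 / d ! j))"
    unfolding qtheta_list_scale_drop_nth[OF assms] by (intro prod.cong) auto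
  then have rest: "qtheta_list (scale_list w (drop_nth k d)) q =
      (\<Prod>j\<in>{..<D} - {k}. g j) * (\<Prod>j\<in>{..<D} - {k}. w - 1 / d ! j)"
    by (simp add: prod.distrib)
  have Hn: "regular_part n w = qtheta_list (scale_list w b) q * w powi (- n) / (\<Prod>j<D. g j)"
    by (simp only: regular_part_def g_def)
  have "(\<Prod>j<D. g j) = g k * (\<Prod>j\<in>{..<D} - {k}. g j)"
    using assms by (intro prod.remove) auto
  then have "regular_part n w = qtheta_list (scale_list w b) q * d ! k powi n /
      (- d ! k * qpoch q q ^ 2 * (\<Prod>j\<in>{..<D} - {k}. g j))"
    unfolding Hn by (simp add: gk) (simp add: w_def power_int_minus power_int_divide_distrib)
  then have "regular_part n w / (w * (\<Prod>j\<in>{..<D} - {k}. w - 1 / d ! j)) =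
     - (qtheta_list (scale_list w b) q * d ! k powi n) / ((w * d ! k) *
       (qpoch q q ^ 2 * ((\<Prod>j\<in>{..<D} - {k}. g j) * (\<Prod>j\<in>{..<D} - {k}. w - 1 / d ! j))))"
    by (simp add: mult_ac)
  also have "\<dots> = - (coeff k * d ! k powi n)"
    unfolding w(1) rest[symmetric] by (simp add: coeff_def w_def mult_ac)
  finally show ?thesis
    by (simp add: w_def)
qed

lemma ratio_step:
  assumes "w \<noteq> 0"
  shows "ratio (w / q) = \<kappa> * w powi (- int p) * ratio w"
proof -
  have D: "D = length b + p"
    using length_le by simp
  have "ratio (w / q) = ((- (w / q)) ^ length b / (- (w / q)) ^ D) * (prod_list b / prod_list d) * ratio w"
    unfolding ratio_def using qtheta_list_scale_step_down[OF q_lt q_nz assms] b_nz d_nz by simp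
  also have "(- (w / q)) ^ length b / (- (w / q)) ^ D = 1 / (- (w / q)) ^ p"
    using assms q_nz by (subst D) (simp add: power_add)
  also have "\<dots> = (- q / w) ^ p"
    using assms q_nz by (simp add: power_divide flip: power_one_over)
  also have "\<dots> = (- q) ^ p * w powi (- int p)"
    unfolding power_divide by (simp add: power_int_minus divide_inverse)
  finally show ?thesis
    by (simp add: \<kappa>_def)
qed

lemma circle_avoids_poles: "sphere 0 \<sigma> \<subseteq> annulus - (\<lambda>k. 1 / d ! k) ` {..<D}"
proof
  fix w :: complex assume "w \<in> sphere 0 \<sigma>"
  moreover have "\<sigma> \<le> norm (1 / q) * \<sigma>"
    using q_lt q_nz \<sigma>_pos by (simp add: norm_divide field_simps)
  ultimately show "w \<in> annulus - (\<lambda>k. 1 / d ! k) ` {..<D}"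
    using closed_annulus_subset[of w] pole_location(1) by auto
qed

lemma holomorphic_ratio: "(\<lambda>w. ratio w * w powi (- n)) holomorphic_on annulus - (\<lambda>k. 1 / d ! k) ` {..<D}"
  unfolding ratio_eq_regular_part
  by (intro holomorphic_intros holomorphic_on_subset[OF holomorphic_regular_part]) (auto simp: prod_zero_iff)

lemma continuous_ratio: "continuous_on (sphere 0 \<sigma>) (\<lambda>w. ratio w * w powi (- n))"
  by (rule continuous_on_subset[OF holomorphic_on_imp_continuous_on[OF holomorphic_ratio] circle_avoids_poles])

text \<open>The mean of \<open>ratio (w / q) * (w / q) powi (- n)\<close> is evaluated twice: moving the circle back across the
  annulus gives \<open>moment n\<close> and the residues, and the functional equation gives a higher moment.\<close>

lemma moment_step: "moment n = (\<Sum>k<D. coeff k * d ! k powi n) + \<kappa> * q powi n * moment (n + int p)"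
proof -
  have "circle_mean \<sigma> (\<lambda>w. regular_part n (1 / q * w) / (\<Prod>k\<in>{..<D}. 1 / q * w - 1 / d ! k)) =
      circle_mean \<sigma> (\<lambda>w. regular_part n w / (\<Prod>k\<in>{..<D}. w - 1 / d ! k)) +
      (\<Sum>k<D. regular_part n (1 / d ! k) / (1 / d ! k * (\<Prod>j\<in>{..<D} - {k}. 1 / d ! k - 1 / d ! j)))"
    using pole_location d_nonempty
    by (intro circle_mean_dilate_simple_poles[where S = annulus] \<sigma>_pos open_annulus holomorphic_regular_part closed_annulus_subset inj_poles) auto
  also have "circle_mean \<sigma> (\<lambda>w. regular_part n w / (\<Prod>k\<in>{..<D}. w - 1 / d ! k)) = moment n"
    by (simp add: moment_def ratio_eq_regular_part)
  also have "(\<Sum>k<D. regular_part n (1 / d ! k) / (1 / d ! k * (\<Prod>j\<in>{..<D} - {k}. 1 / d ! k - 1 / d ! j))) =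
      - (\<Sum>k<D. coeff k * d ! k powi n)"
    unfolding sum_negf[symmetric] by (intro sum.cong residue_eq) auto
  finally have 1: "circle_mean \<sigma> (\<lambda>w. ratio (w / q) * (w / q) powi (- n)) = moment n - (\<Sum>k<D. coeff k * d ! k powi n)"
    by (simp add: ratio_eq_regular_part)
  have "circle_mean \<sigma> (\<lambda>w. ratio (w / q) * (w / q) powi (- n)) =
      circle_mean \<sigma> (\<lambda>w. (\<kappa> * q powi n) * (ratio w * w powi (- (n + int p))))"
  proof (rule circle_mean_cong[OF \<sigma>_pos])
    fix w :: complex assume "norm w = \<sigma>"
    then have "w \<noteq> 0"
      using \<sigma>_pos by auto
    moreover have "- (n + int p) = - int p + (- n)"
      by simp
    ultimately have "w powi (- (n + int p)) = w powi (- int p) * w powi (- n)"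
      using power_int_add[of w "- int p" "- n"] by (simp only:) simp
    moreover have "(w / q) powi (- n) = w powi (- n) * q powi n"
      by (simp add: power_int_minus power_int_divide_distrib) (simp add: divide_inverse mult.commute)
    ultimately show "ratio (w / q) * (w / q) powi (- n) = (\<kappa> * q powi n) * (ratio w * w powi (- (n + int p)))"
      using ratio_step[OF \<open>w \<noteq> 0\<close>] by simp
  qed
  also have "\<dots> = \<kappa> * q powi n * moment (n + int p)"
    unfolding moment_def by (rule circle_mean_cmult[OF \<sigma>_pos continuous_ratio])
  finally show ?thesis
    using 1 by (simp add: algebra_simps)
qed

lemma moment_bound: "\<exists>M. \<forall>n. norm (moment n) \<le> M * \<sigma> powi (- n)"
proof -
  have "continuous_on (sphere 0 \<sigma>) ratio"
    using continuous_ratio[of 0] by simp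
  then have "bounded (ratio ` sphere 0 \<sigma>)"
    by (intro compact_imp_bounded compact_continuous_image) auto
  then obtain M where "\<forall>w\<in>sphere 0 \<sigma>. norm (ratio w) \<le> M"
    by (auto simp: bounded_iff)
  then have M: "norm (ratio w) \<le> M" if "norm w = \<sigma>" for w
    using that by simp
  have "norm (moment n) \<le> M * \<sigma> powi (- n)" for n
    unfolding moment_def using M \<sigma>_pos
    by (intro circle_mean_bound continuous_ratio) (auto simp: norm_mult norm_power_int mult_right_mono)
  then show ?thesis
    by blast
qed

lemma moment_iterate:
  fixes m :: int
  defines "W \<equiv> (\<lambda>i. \<Prod>j<i. \<kappa> * q powi (m + int (p * j)))"
  shows "moment m = (\<Sum>i<N. W i * (\<Sum>k<D. coeff k * d ! k powi (m + int (p * i)))) + W N * moment (m + int (p * N))"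
proof (induction N)
  case (Suc N)
  have "m + int (p * N) + int p = m + int (p * Suc N)"
    by simp
  then have "moment (m + int (p * N)) = (\<Sum>k<D. coeff k * d ! k powi (m + int (p * N))) +
      \<kappa> * q powi (m + int (p * N)) * moment (m + int (p * Suc N))"
    using moment_step[of "m + int (p * N)"] by (simp only:)
  moreover have "W (Suc N) = W N * (\<kappa> * q powi (m + int (p * N)))"
    by (simp add: W_def)
  ultimately show ?case
    using Suc.IH by (simp add: distrib_left mult.assoc)
qed (simp add: W_def)

text \<open>The parameter \<open>y\<close> absorbs either the powers of \<open>d ! k\<close> in the residues or the growth
  \<open>\<sigma> powi (- n)\<close> of the remainder, so that both are governed by the same series.\<close>

lemma weight_eq_Phi_term:
  "(\<Prod>j<i. \<kappa> * q powi (m + int (p * j))) * y ^ i = Phi_term q p ((-1) ^ p * \<kappa> * q powi m * y) i"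
proof (induction i)
  case (Suc i)
  have "q powi (m + int (p * i)) = q powi m * (q ^ p) ^ i"
    using q_nz by (rule power_int_add_mult)
  moreover have "(-1) ^ p * ((-1) ^ p * \<kappa> * q powi m * y) = \<kappa> * q powi m * y"
    by (simp flip: power_mult_distrib mult.assoc)
  ultimately show ?case
    unfolding Phi_term_Suc using Suc.IH[symmetric] by (simp add: mult_ac)
qed simp

text \<open>Let the number of iterations tend to infinity. At \<open>y = d ! k\<close> the terms \<open>Phi_term q p (X y) i\<close> are the
  summands of the result; at \<open>y = 1 / \<sigma>\<close> they dominate the remainder.\<close>

lemma moment_eq_sum_Phi:
  assumes "p = 0 \<Longrightarrow> norm (q powi m * prod_list b) < norm (prod_list d)"
  shows "moment m = (\<Sum>k<D. coeff k * d ! k powi m * Phi q p (q powi m * (q * d ! k) ^ p * prod_list b / prod_list d))"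
proof -
  define W where "W = (\<lambda>i. \<Prod>j<i. \<kappa> * q powi (m + int (p * j)))"
  define X where "X = (\<lambda>y. (-1) ^ p * \<kappa> * q powi m * y ^ p)"
  have W: "W i * (y ^ p) ^ i = Phi_term q p (X y) i" for y i
    unfolding W_def X_def by (rule weight_eq_Phi_term)
  have X: "X y = q powi m * (q * y) ^ p * prod_list b / prod_list d" for y
  proof -
    have "(-1) ^ p * (- q) ^ p = q ^ p"
      by (simp flip: power_mult_distrib)
    then have "(-1) ^ p * \<kappa> = q ^ p * (prod_list b / prod_list d)"
      by (simp add: \<kappa>_def flip: mult.assoc)
    then show ?thesis
      by (simp add: X_def power_mult_distrib)
  qed
  have X_lt: "norm (X y) < 1" if "p = 0" for y
  proof -
    have "prod_list d \<noteq> 0"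
      using assms[OF that] by auto
    then show ?thesis
      using assms[OF that] that by (simp add: X norm_divide norm_mult)
  qed
  have summand: "W i * (\<Sum>k<D. coeff k * d ! k powi (m + int (p * i))) = (\<Sum>k<D. coeff k * d ! k powi m * Phi_term q p (X (d ! k)) i)" for i
    unfolding sum_distrib_left
  proof (rule sum.cong)
    fix k assume "k \<in> {..<D}"
    then have "d ! k powi (m + int (p * i)) = d ! k powi m * (d ! k ^ p) ^ i"
      using d_nz by (intro power_int_add_mult) simp
    then show "W i * (coeff k * d ! k powi (m + int (p * i))) = coeff k * d ! k powi m * Phi_term q p (X (d ! k)) i"
      unfolding W[symmetric] by simp
  qed simp
  have main: "(\<lambda>N. \<Sum>i<N. W i * (\<Sum>k<D. coeff k * d ! k powi (m + int (p * i))))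
      \<longlonglongrightarrow> (\<Sum>k<D. coeff k * d ! k powi m * Phi q p (X (d ! k)))"
    unfolding summand sums_def[symmetric]
    by (intro sums_sum sums_mult Phi_sums q_lt X_lt)
  obtain M where M: "norm (moment n) \<le> M * \<sigma> powi (- n)" for n
    using moment_bound by blast
  have rest: "(\<lambda>N. W N * moment (m + int (p * N))) \<longlonglongrightarrow> 0"
  proof (rule Lim_null_comparison)
    let ?y = "of_real (1 / \<sigma>) :: complex"
    show "eventually (\<lambda>N. norm (W N * moment (m + int (p * N))) \<le>
        M * \<sigma> powi (- m) * norm (Phi_term q p (X ?y) N)) sequentially"
    proof (intro always_eventually allI)
      fix N
      have "\<sigma> powi (- (m + int (p * N))) = \<sigma> powi (- m) * ((1 / \<sigma>) ^ p) ^ N"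
        unfolding power_int_minus power_int_add_mult[OF less_imp_neq[OF \<sigma>_pos, symmetric]]
        by (simp add: power_one_over divide_inverse flip: power_inverse)
      then have "norm (W N * moment (m + int (p * N))) \<le> norm (W N) * (M * (\<sigma> powi (- m) * ((1 / \<sigma>) ^ p) ^ N))"
        unfolding norm_mult using M[of "m + int (p * N)"] by (simp add: mult_left_mono)
      also have "\<dots> = M * \<sigma> powi (- m) * norm (W N * (?y ^ p) ^ N)"
        using \<sigma>_pos by (simp add: norm_mult norm_power norm_divide)
      finally show "norm (W N * moment (m + int (p * N))) \<le> M * \<sigma> powi (- m) * norm (Phi_term q p (X ?y) N)"
        unfolding W .
    qed
    have "Phi_term q p (X ?y) \<longlonglongrightarrow> 0"
      by (intro summable_LIMSEQ_zero summable_Phi_term q_lt X_lt)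
    then show "(\<lambda>N. M * \<sigma> powi (- m) * norm (Phi_term q p (X ?y) N)) \<longlonglongrightarrow> 0"
      by (intro tendsto_mult_right_zero tendsto_norm_zero)
  qed
  have "(\<lambda>N. moment m) \<longlonglongrightarrow> (\<Sum>k<D. coeff k * d ! k powi m * Phi q p (X (d ! k))) + 0"
    using tendsto_add[OF main rest] moment_iterate[of m] unfolding W_def by simp
  then show ?thesis
    using LIMSEQ_unique[OF tendsto_const] by (simp add: X)
qed

lemma integral_eq_moment:
  "((\<lambda>\<psi>. let z = cis \<psi> in
      qtheta_list (scale_list (of_real \<sigma> / z) b) q / qtheta_list (scale_list (of_real \<sigma> / z) d) q *
      exp (\<i> * of_int m * of_real \<psi>))
    has_integral (2 * of_real pi * of_real \<sigma> powi m * moment m)) {-pi..pi}"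
proof -
  have "open (annulus - (\<lambda>k. 1 / d ! k) ` {..<D})"
    using open_annulus by (intro open_Diff finite_imp_closed) auto
  from has_integral_mult_right[OF has_integral_circle_mean[OF \<sigma>_pos this holomorphic_ratio[of m] circle_avoids_poles], of "of_real \<sigma> powi m"]
  have "((\<lambda>\<psi>. of_real \<sigma> powi m * (ratio (of_real \<sigma> / cis \<psi>) * (of_real \<sigma> / cis \<psi>) powi (- m))) has_integral
      2 * of_real pi * of_real \<sigma> powi m * moment m) {-pi..pi}"
    by (simp add: moment_def mult_ac)
  moreover have "of_real \<sigma> powi m * (ratio (of_real \<sigma> / cis \<psi>) * (of_real \<sigma> / cis \<psi>) powi (- m)) =
      ratio (of_real \<sigma> / cis \<psi>) * exp (\<i> * of_int m * of_real \<psi>)" for \<psi>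
  proof -
    have "exp (\<i> * of_int m * of_real \<psi>) = cis \<psi> powi m"
      unfolding cis_power_int by (simp add: cis_conv_exp mult_ac)
    then show ?thesis
      using \<sigma>_pos by (simp add: power_int_minus power_int_divide_distrib)
  qed
  ultimately have "((\<lambda>\<psi>. ratio (of_real \<sigma> / cis \<psi>) * exp (\<i> * of_int m * of_real \<psi>)) has_integral
      2 * of_real pi * of_real \<sigma> powi m * moment m) {-pi..pi}"
    by (simp only:)
  then show ?thesis
    by (simp only: ratio_def Let_def)
qed

text \<open>With \<open>q / b\<close> and \<open>q / d\<close> as the other two lists, the four products pair up to theta functions.\<close>

lemma q_Mellin_Barnes_eq_moment: "q_Mellin_Barnes m (recip_list q b) b (recip_list q d) d \<sigma> q = qpoch q q * moment m"
proof -
  have *: "qpoch_list (scale_list (of_real \<sigma> / z) xs) q * qpoch_list (scale_list (z / of_real \<sigma>) (recip_list q xs)) q =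
      qtheta_list (scale_list (of_real \<sigma> / z) xs) q" for z xs
    using qpoch_list_pair_eq_qtheta_list[of "of_real \<sigma> / z" xs] by simp
  show ?thesis
    unfolding q_Mellin_Barnes_def * integral_unique[OF integral_eq_moment]
    using \<sigma>_pos by (simp add: power_int_minus)
qed

lemma qpoch_q_nz: "qpoch q q \<noteq> 0"
  using qpoch_nonzero[OF q_lt q_lt] .

lemma q_Mellin_Barnes_eq_sum_Phi:
  assumes "D = length b \<longrightarrow> norm (q powi m * prod_list b) < norm (prod_list d)"
  shows "q_Mellin_Barnes m (recip_list q b) b (recip_list q d) d \<sigma> q = 1 / qpoch q q *
    (\<Sum>k<D. qtheta_list (scale_list (1 / d ! k) b) q * d ! k powi m /
      qtheta_list (scale_list (1 / d ! k) (drop_nth k d)) q *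
      Phi q p (q powi m * (q * d ! k) ^ p * prod_list b / prod_list d))"
proof -
  have moment: "moment m = (\<Sum>k<D. coeff k * d ! k powi m * Phi q p (q powi m * (q * d ! k) ^ p * prod_list b / prod_list d))"
    by (rule moment_eq_sum_Phi) (use assms length_le in simp)
  show ?thesis
    unfolding q_Mellin_Barnes_eq_moment moment sum_distrib_left
    using qpoch_q_nz by (intro sum.cong) (auto simp: coeff_def power2_eq_square mult_ac)
qed

end

section \<open>Evaluation of the integral\<close>

theorem theorem2p1:
  fixes q :: complex and m :: int and \<sigma> :: real and B D :: nat and b d :: "complex list"
  assumes "0 < norm q" and "norm q < 1"
    and "0 < \<sigma>"
    and "1 \<le> D" and "B \<le> D"
    and "length b = B" and "length d = D"
    and "\<forall>j<B. b ! j \<noteq> 0" and "\<forall>k<D. d ! k \<noteq> 0"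
    and "\<forall>k<D. norm q / \<sigma> < norm (d ! k) \<and> norm (d ! k) < 1 / \<sigma>"
    and "\<forall>k<D. \<forall>l<D. l \<noteq> k \<longrightarrow> d ! l / d ! k \<notin> {q powi j |j :: int. True}"
  shows
    "let G = q_Mellin_Barnes m (recip_list q b) b (recip_list q d) d \<sigma> q in
      ((\<lambda>\<psi>. let z = cis \<psi> in
          qtheta_list (scale_list (of_real \<sigma> / z) b) q / qtheta_list (scale_list (of_real \<sigma> / z) d) q *
          exp (\<i> * of_int m * of_real \<psi>))
        has_integral (2 * of_real pi * of_real \<sigma> powi m / qpoch q q * G)) {-pi..pi}
      \<and> ((D = B \<longrightarrow> norm (q powi m * prod_list b) < norm (prod_list d)) \<longrightarrow>
          G = 1 / qpoch q q *
            (\<Sum>k<D. qtheta_list (scale_list (1 / d ! k) b) q * d ! k powi m /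
                    qtheta_list (scale_list (1 / d ! k) (drop_nth k d)) q *
                    Phi q (D - B) (q powi m * (q * d ! k) ^ (D - B) * prod_list b / prod_list d)))
      \<and> (D = B \<and> norm (q powi m * prod_list b) < norm (prod_list d) \<longrightarrow>
          G = 1 / qpoch q q *
            (\<Sum>k<D. qtheta_list (scale_list (1 / d ! k) b) q * d ! k powi m /
                    qtheta_list (scale_list (1 / d ! k) (drop_nth k d)) q *
                    (1 / (1 - q powi m * (prod_list b / prod_list d)))))
      \<and> (D > B \<longrightarrow>
          G = qpoch (q ^ (D - B)) (q ^ (D - B)) / qpoch q q *
            (\<Sum>k<D. qtheta_list (scale_list (1 / d ! k) b) q * d ! k powi m /
                    qtheta_list (scale_list (1 / d ! k) (drop_nth k d)) q *
                    partial_theta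
                      (- (q powi m * (- q * d ! k) ^ (D - B) * prod_list b / prod_list d))
                      (q ^ (D - B))))"
proof -
  have "d ! l \<noteq> d ! k" if "k < D" "l < D" "l \<noteq> k" for k l
  proof
    assume "d ! l = d ! k"
    then have "d ! l / d ! k = q powi 0"
      using assms(9) that(1) by simp
    then show False
      using assms(11) that by blast
  qed
  then have "distinct d"
    using assms(7) by (auto simp: distinct_conv_nth)
  then interpret theta_quotient q \<sigma> b d
    using assms by unfold_locales auto
  let ?G = "q_Mellin_Barnes m (recip_list q b) b (recip_list q d) d \<sigma> q"
  let ?c = "\<lambda>k. qtheta_list (scale_list (1 / d ! k) b) q * d ! k powi m /
    qtheta_list (scale_list (1 / d ! k) (drop_nth k d)) q"
  let ?x = "\<lambda>k. q powi m * (q * d ! k) ^ (D - B) * prod_list b / prod_list d"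
  have lengths: "length b = B" "length d = D"
    using assms(6,7) by auto
  have i: "?G = 1 / qpoch q q * (\<Sum>k<D. ?c k * Phi q (D - B) (?x k))"
    if "D = B \<longrightarrow> norm (q powi m * prod_list b) < norm (prod_list d)"
    using q_Mellin_Barnes_eq_sum_Phi[of m] that unfolding lengths by blast
  have int: "((\<lambda>\<psi>. let z = cis \<psi> in
          qtheta_list (scale_list (of_real \<sigma> / z) b) q / qtheta_list (scale_list (of_real \<sigma> / z) d) q *
          exp (\<i> * of_int m * of_real \<psi>))
        has_integral (2 * of_real pi * of_real \<sigma> powi m / qpoch q q * ?G)) {-pi..pi}"
    using integral_eq_moment[of m] qpoch_q_nz unfolding q_Mellin_Barnes_eq_moment by (simp add: mult.assoc)
  have ii: "?G = 1 / qpoch q q * (\<Sum>k<D. ?c k * (1 / (1 - q powi m * (prod_list b / prod_list d))))"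
    if "D = B \<and> norm (q powi m * prod_list b) < norm (prod_list d)"
  proof -
    have "prod_list d \<noteq> 0"
      using that by auto
    then have "norm (q powi m * (prod_list b / prod_list d)) < 1"
      using that by (simp add: norm_mult norm_divide)
    then show ?thesis
      using i that Phi_0 by simp
  qed
  have iii: "?G = qpoch (q ^ (D - B)) (q ^ (D - B)) / qpoch q q *
      (\<Sum>k<D. ?c k * partial_theta (- (q powi m * (- q * d ! k) ^ (D - B) * prod_list b / prod_list d)) (q ^ (D - B)))"
    if "D > B"
  proof -
    have "(-1) ^ (D - B) * ?x k = q powi m * (- q * d ! k) ^ (D - B) * prod_list b / prod_list d" for k
      by (simp add: power_minus[of "q * d ! k"] power_mult_distrib)
    then have "Phi q (D - B) (?x k) = qpoch (q ^ (D - B)) (q ^ (D - B)) *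
        partial_theta (- (q powi m * (- q * d ! k) ^ (D - B) * prod_list b / prod_list d)) (q ^ (D - B))" for k
      using Phi_eq_partial_theta[OF q_lt, of "D - B" "?x k"] that by (simp only: zero_less_diff)
    then show ?thesis
      using i that by (simp add: sum_distrib_left mult_ac)
  qed
  show ?thesis
    unfolding Let_def using int i ii iii by (simp only: Let_def) blast
qed

end
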